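(* Let $\mathcal{A} = \{n \ge 1 : \sigma(n) \ge 2n\}$ be the set of nondeficient positive integers, and let $\mathcal{P}$ be the set of positive $\{-1,1\}$-perfect numbers. There exists a set $\mathcal{E} \subseteq \mathcal{A} \setminus \mathcal{P}$ satisfying $\underline{d}(\mathcal{E}) > 0$. Consequently, the strict inequality $\overline{d}(\mathcal{P}) < d(\mathcal{A})$ holds.
   Context: $\sigma(n) = \sum_{d \mid n} d$ is the sum of the positive divisors of $n$. For a positive integer $n$, write its positive divisors as $1 = d_0 < d_1 < \cdots < d_k < d_{k+1} = n$ (so $n>1$, and $k=0$ is allowed). The integer $n$ is $\{-1,1\}$-perfect if there are $\lambda_1, \ldots, \lambda_k \in \{-1,1\}$ with $1 + \sum_{j=1}^{k} \lambda_j d_j = n$. For a set $\mathcal{S}$ of positive integers, $\overline{d}(\mathcal{S}) = \limsup_{x\to\infty} \frac{1}{x}\#\{n \le x : n \in \mathcal{S}\}$ and $\underline{d}(\mathcal{S}) = \liminf_{x\to\infty} \frac{1}{x}\#\{n \le x : n \in \mathcal{S}\}$; when these are equal, their common value is denoted $d(\mathcal{S})$. It is a known theorem (Davenport, 1933) that the natural density $d(\mathcal{A})$ exists. *)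

theory Defs
  imports "HOL-Analysis.Analysis"
begin

definition divisor_sum :: "nat \<Rightarrow> nat" where
  "divisor_sum n = (\<Sum>d | d dvd n. d)"

definition nondeficient_numbers :: "nat set" where
  "nondeficient_numbers = {n. 1 \<le> n \<and> 2 * n \<le> divisor_sum n}"

text \<open>
  The signs are indexed by the divisors \<open>1 < d < n\<close> themselves rather than by their position
  in the increasing enumeration of the divisors of \<open>n\<close>. The value of \<open>l\<close> elsewhere is irrelevant.
\<close>

definition pm_one_perfect :: "nat \<Rightarrow> bool" where
  "pm_one_perfect n \<longleftrightarrow> 1 < n \<and>
     (\<exists>l :: nat \<Rightarrow> int. (\<forall>d. d dvd n \<and> 1 < d \<and> d < n \<longrightarrow> l d \<in> {-1, 1}) \<and>
        1 + (\<Sum>d | d dvd n \<and> 1 < d \<and> d < n. l d * int d) = int n)"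

definition pm_one_perfect_numbers :: "nat set" where
  "pm_one_perfect_numbers = {n. pm_one_perfect n}"

text \<open>
  Densities of sets of positive integers: the element \<open>0\<close>, if present, is not counted.
  The variable \<open>x\<close> tends to infinity through the reals.
\<close>

definition counting_ratio :: "nat set \<Rightarrow> real \<Rightarrow> real" where
  "counting_ratio S x = real (card {n \<in> S. 1 \<le> n \<and> real n \<le> x}) / x"

definition upper_density :: "nat set \<Rightarrow> ereal" where
  "upper_density S = Limsup at_top (\<lambda>x. ereal (counting_ratio S x))"

definition lower_density :: "nat set \<Rightarrow> ereal" where
  "lower_density S = Liminf at_top (\<lambda>x. ereal (counting_ratio S x))"

definition has_natural_density :: "nat set \<Rightarrow> ereal \<Rightarrow> bool" where
  "has_natural_density S \<delta> \<longleftrightarrow> lower_density S = \<delta> \<and> upper_density S = \<delta>"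

end

theory Submission
  imports Defs "HOL-Computational_Algebra.Squarefree"
begin

text \<open>
  Write \<open>h n = (\<Sum>d | d dvd n. 1 / d)\<close>, so that \<open>n\<close> is nondeficient iff \<open>h n \<ge> 2\<close>, and let \<open>h\<^sub>K\<close> be the
  sum restricted to \<open>d \<le> K\<close>, which is periodic modulo \<open>K!\<close>.

  The density of the nondeficient numbers exists because they are approximated by the periodic sets
  \<open>h\<^sub>K n \<ge> 2\<close>: on average \<open>h - h\<^sub>K\<close> is at most \<open>1 / K\<close>, and the window \<open>2 - \<epsilon> \<le> h\<^sub>K n < 2\<close> is rare
  uniformly in \<open>K\<close>. For the latter, let \<open>Q\<close> be a finite set of primes with \<open>\<epsilon> \<le> 1 / p\<close> for \<open>p \<in> Q\<close>
  and put \<open>\<mu> = (\<Sum>p\<in>Q. 1 / p)\<close>. Multiplying a window element \<open>m\<close> by a \<open>p \<in> Q\<close> not dividing it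
  lifts \<open>h\<^sub>K\<close> to at least 2, so the window contributes about \<open>\<mu>\<close> times its density to the covariance
  of the indicator of \<open>h\<^sub>K \<ge> 2\<close> with the number of prime divisors in \<open>Q\<close>; that covariance is at most
  the standard deviation \<open>\<surd>\<mu>\<close>. As the sum of the reciprocals of the primes diverges, \<open>\<mu>\<close> can be
  taken arbitrarily large.

  For the exceptional set, a \<open>{-1, 1}\<close>-perfect \<open>n\<close> admits signs with \<open>(\<Sum>d | d dvd n. \<plusminus>1 / d) = 0\<close>. If
  \<open>n = 18 q\<close>, the divisors of 18 contribute an odd multiple of \<open>1 / 18\<close>, since \<open>\<sigma>(18) = 39\<close> is odd,
  and the others contribute at most \<open>h 18 * (h q - 1)\<close>, which is too small to cancel it when
  \<open>h q < 1 + 1 / 39\<close>. Averaging \<open>h q - 1\<close> over \<open>q \<equiv> 1\<close> modulo \<open>78!\<close> shows that a positive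
  proportion of all integers are of this form.
\<close>

section \<open>Truncated abundancy\<close>

definition abundancy :: "nat \<Rightarrow> real" where
  "abundancy n = (\<Sum>d | d dvd n. 1 / real d)"

definition truncated_abundancy :: "nat \<Rightarrow> nat \<Rightarrow> real" where
  "truncated_abundancy K n = (\<Sum>d | d \<in> {1..K} \<and> d dvd n. 1 / real d)"

section \<open>Sums of periodic functions and sums over multiples\<close>

lemma periodic_mult:
  fixes f :: "nat \<Rightarrow> 'a"
  assumes "\<And>n. f (n + L) = f n"
  shows "f (n + k * L) = f n"
proof (induction k)
  case (Suc k)
  then show ?case using assms[of "n + k * L"] by (simp add: algebra_simps)
qed simp

lemma sum_periodic:
  fixes f :: "nat \<Rightarrow> real"
  assumes "\<And>n. f (n + L) = f n"
  shows "(\<Sum>n = 1..k * L. f n) = real k * (\<Sum>n = 1..L. f n)"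
proof (induction k)
  case (Suc k)
  have "(\<Sum>n = 1..Suc k * L. f n) = (\<Sum>n = 1..k * L. f n) + (\<Sum>n = k * L + 1..k * L + L. f n)"
    using sum.ub_add_nat[of 1 "k * L" f L] by (simp add: add.commute[of L])
  also have "(\<Sum>n = k * L + 1..k * L + L. f n) = (\<Sum>n = 1..L. f (n + k * L))"
    using sum.shift_bounds_cl_nat_ivl[of f 1 "k * L" L] by (simp only: add.commute)
  also have "\<dots> = (\<Sum>n = 1..L. f n)"
    using periodic_mult[of f L, OF assms] by simp
  finally show ?case using Suc by (simp add: algebra_simps)
qed simp

lemma multiples_atLeastAtMost:
  assumes "0 < (d::nat)"
  shows "{n \<in> {1..N}. d dvd n} = (\<lambda>m. d * m) ` {1..N div d}"
proof (intro equalityI subsetI)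
  fix n assume "n \<in> {n \<in> {1..N}. d dvd n}"
  then obtain m where "n = d * m" "1 \<le> d * m" "d * m \<le> N" by auto
  moreover from this have "1 \<le> m" by (cases m) auto
  moreover have "m \<le> N div d" using \<open>d * m \<le> N\<close> assms
    by (simp add: less_eq_div_iff_mult_less_eq mult.commute)
  ultimately show "n \<in> (\<lambda>m. d * m) ` {1..N div d}" by auto
next
  fix n assume "n \<in> (\<lambda>m. d * m) ` {1..N div d}"
  then show "n \<in> {n \<in> {1..N}. d dvd n}" using assms
    by (auto simp: less_eq_div_iff_mult_less_eq mult.commute)
qed

lemma sum_multiples:
  fixes f :: "nat \<Rightarrow> 'a :: comm_monoid_add"
  assumes "0 < (d::nat)"
  shows "(\<Sum>n | n \<in> {1..N} \<and> d dvd n. f n) = (\<Sum>m = 1..N div d. f (d * m))"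
proof -
  have "inj_on ((*) d) {1..N div d}" using assms by (auto simp: inj_on_def)
  then show ?thesis
    using multiples_atLeastAtMost[OF assms, of N] by (simp add: sum.reindex)
qed

lemma card_multiples:
  assumes "0 < (d::nat)"
  shows "card {n \<in> {1..N}. d dvd n} = N div d"
  using sum_multiples[OF assms, of "\<lambda>_. 1::nat" N] by simp

lemma card_multiples_le: "real (card {n \<in> {1..N}. d dvd n}) \<le> real N / real d"
proof (cases "d = 0")
  case False
  then show ?thesis using card_multiples[of d N] by (simp add: of_nat_div_le_of_nat)
next
  \<comment> \<open>Division by zero yields 0, which agrees with the count since 0 divides no
    positive number.\<close>
  case True
  then have "{n \<in> {1..N}. d dvd n} = {}" by auto
  then show ?thesis using True by simp
qed

text \<open>The function \<open>m \<mapsto> f (p * m)\<close> has period \<open>M div p\<close>, so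
  the right-hand sum runs through \<open>p\<close> of its periods; a single period is the sum over
  the multiples of \<open>p\<close>.\<close>

lemma sum_periodic_multiples:
  fixes f :: "nat \<Rightarrow> real"
  assumes per: "\<And>n. f (n + M) = f n" and "p dvd M" "0 < p"
  shows "real p * (\<Sum>n | n \<in> {1..M} \<and> p dvd n. f n) = (\<Sum>m = 1..M. f (p * m))"
proof -
  obtain L where L: "M = p * L" using \<open>p dvd M\<close> by auto
  have "(\<Sum>m = 1..p * L. f (p * m)) = real p * (\<Sum>m = 1..L. f (p * m))"
    using per L by (intro sum_periodic) (simp add: algebra_simps)
  then show ?thesis using sum_multiples[OF \<open>0 < p\<close>, of f M] L \<open>0 < p\<close> by simp
qed

lemma sum_inverse_squares_le:
  assumes "0 < K"
  shows "(\<Sum>d = Suc K..N. 1 / real d ^ 2) \<le> 1 / real K"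
proof (cases "K \<le> N")
  case True
  then have "(\<Sum>d = Suc K..N. 1 / real d ^ 2) \<le> 1 / real K - 1 / real N"
  proof (induction rule: dec_induct)
    case (step n)
    have "1 / real (Suc n) ^ 2 \<le> 1 / (real n * real (Suc n))"
      using step assms by (intro divide_left_mono) (auto simp: power2_eq_square)
    also have "\<dots> = 1 / real n - 1 / real (Suc n)"
      using step assms by (simp add: field_simps)
    finally show ?case using step by simp
  qed simp
  also have "\<dots> \<le> 1 / real K" by simp
  finally show ?thesis .
qed simp

section \<open>Elementary properties of the abundancy and its truncation\<close>

lemma truncated_abundancy_periodic:
  "truncated_abundancy K (n + fact K) = truncated_abundancy K n"
proof -
  have "d dvd n + fact K \<longleftrightarrow> d dvd n" if "d \<in> {1..K}" for d :: nat
    using that by (simp add: dvd_add_left_iff dvd_fact)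
  then have "{d. d \<in> {1..K} \<and> d dvd n + fact K} = {d. d \<in> {1..K} \<and> d dvd n}" by blast
  then show ?thesis unfolding truncated_abundancy_def by simp
qed

lemma truncated_abundancy_mono:
  assumes "m dvd n"
  shows "truncated_abundancy K m \<le> truncated_abundancy K n"
  unfolding truncated_abundancy_def
  using assms dvd_trans by (intro sum_mono2) auto

lemma truncated_abundancy_mult_ge:
  assumes "\<not> p dvd m" "p \<in> {1..K}"
  shows "truncated_abundancy K m + 1 / real p \<le> truncated_abundancy K (p * m)"
proof -
  have "truncated_abundancy K m + 1 / real p
      = (\<Sum>d \<in> insert p {d. d \<in> {1..K} \<and> d dvd m}. 1 / real d)"
    unfolding truncated_abundancy_def using assms by (subst sum.insert) auto
  also have "\<dots> \<le> truncated_abundancy K (p * m)"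
    unfolding truncated_abundancy_def using assms by (intro sum_mono2) auto
  finally show ?thesis .
qed

lemma abundancy_mono:
  assumes "m dvd n" "0 < n"
  shows "abundancy m \<le> abundancy n"
  unfolding abundancy_def using assms dvd_trans by (intro sum_mono2) auto

text \<open>The limit \<open>N\<close> in place of \<open>n\<close> makes the range of
  \<open>d\<close> the same for all \<open>n \<le> N\<close>, so that sums over \<open>n\<close> and
  \<open>d\<close> can be interchanged.\<close>

lemma abundancy_eq_truncated_plus:
  assumes "n \<in> {1..N}"
  shows "abundancy n = truncated_abundancy K n + (\<Sum>d | d \<in> {Suc K..N} \<and> d dvd n. 1 / real d)"
proof -
  let ?A = "{d. d \<in> {1..K} \<and> d dvd n}" and ?B = "{d. d \<in> {Suc K..N} \<and> d dvd n}"
  have "{d. d dvd n} = ?A \<union> ?B"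
    using assms by (auto dest: dvd_imp_le intro: Suc_leI Nat.gr0I)
  moreover have "sum f (?A \<union> ?B) = sum f ?A + sum f ?B" for f :: "nat \<Rightarrow> real"
    by (rule sum.union_disjoint) auto
  ultimately show ?thesis unfolding abundancy_def truncated_abundancy_def by metis
qed

lemma truncated_abundancy_le:
  assumes "0 < n"
  shows "truncated_abundancy K n \<le> abundancy n"
  using abundancy_eq_truncated_plus[of n n K] assms by (simp add: sum_nonneg)

lemma abundancy_eq_divisor_sum:
  assumes "0 < n"
  shows "abundancy n = real (divisor_sum n) / real n"
proof -
  have "(\<Sum>d | d dvd n. 1 / real d) = (\<Sum>d | d dvd n. real d / real n)"
    using assms
    by (intro sum.reindex_bij_witness[of _ "\<lambda>d. n div d" "\<lambda>d. n div d"])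
       (auto simp: real_of_nat_div)
  then show ?thesis unfolding abundancy_def divisor_sum_def by (simp add: sum_divide_distrib)
qed

lemma nondeficient_iff_abundancy:
  "n \<in> nondeficient_numbers \<longleftrightarrow> 0 < n \<and> 2 \<le> abundancy n"
proof (cases "0 < n")
  case True
  have "2 \<le> abundancy n \<longleftrightarrow> real (2 * n) \<le> real (divisor_sum n)"
    using True by (simp add: abundancy_eq_divisor_sum field_simps)
  then show ?thesis using True unfolding nondeficient_numbers_def of_nat_le_iff by auto
qed (simp add: nondeficient_numbers_def)

section \<open>Average size of the truncation error\<close>

lemma card_le_sum_divide:
  fixes f :: "'a \<Rightarrow> real"
  assumes "finite A" "0 < c" "\<And>x. x \<in> A \<Longrightarrow> 0 \<le> f x"
  shows "real (card {x \<in> A. c \<le> f x}) \<le> (\<Sum>x\<in>A. f x) / c"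
proof -
  have "real (card {x \<in> A. c \<le> f x}) * c = (\<Sum>x | x \<in> A \<and> c \<le> f x. c)" by simp
  also have "\<dots> \<le> (\<Sum>x | x \<in> A \<and> c \<le> f x. f x)" by (intro sum_mono) auto
  also have "\<dots> \<le> (\<Sum>x\<in>A. f x)" using assms by (intro sum_mono2) auto
  finally show ?thesis using assms by (simp add: field_simps)
qed

lemma sum_of_bool_card:
  assumes "finite A"
  shows "(\<Sum>n\<in>A. of_bool (P n)) = real (card {n \<in> A. P n})"
  using assms by (simp add: of_bool_def sum.If_cases Int_def)

text \<open>Markov's inequality: a divisor \<open>d > K\<close> of weight \<open>1 / d\<close>
  divides at most \<open>N / d\<close> of the numbers, so the total error is at most
  \<open>N\<close> times the tail of the series of inverse squares.\<close>

lemma card_tail_ge: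
  assumes "0 < K" "0 < \<epsilon>"
  shows "real (card {n \<in> {1..N}. \<epsilon> \<le> abundancy n - truncated_abundancy K n})
    \<le> real N / (real K * \<epsilon>)"
proof -
  have "(\<Sum>n = 1..N. abundancy n - truncated_abundancy K n)
      = (\<Sum>n = 1..N. \<Sum>d | d \<in> {Suc K..N} \<and> d dvd n. 1 / real d)"
    by (intro sum.cong refl) (simp add: abundancy_eq_truncated_plus[where K = K and N = N])
  also have "\<dots> = (\<Sum>d = Suc K..N. \<Sum>n | n \<in> {1..N} \<and> d dvd n. 1 / real d)"
    by (rule sum.swap_restrict) auto
  also have "\<dots> = (\<Sum>d = Suc K..N. real (card {n \<in> {1..N}. d dvd n}) / real d)" by simp
  also have "\<dots> \<le> (\<Sum>d = Suc K..N. real N * (1 / real d ^ 2))"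
    using card_multiples_le[of N]
    by (intro sum_mono) (auto simp: power2_eq_square divide_right_mono simp flip: divide_divide_eq_left)
  also have "\<dots> \<le> real N * (1 / real K)"
    using sum_inverse_squares_le[OF assms(1)]
    by (subst sum_distrib_left[symmetric]) (intro mult_left_mono, auto)
  finally have *: "(\<Sum>n = 1..N. abundancy n - truncated_abundancy K n) \<le> real N / real K" by simp
  have "real (card {n \<in> {1..N}. \<epsilon> \<le> abundancy n - truncated_abundancy K n})
      \<le> (\<Sum>n = 1..N. abundancy n - truncated_abundancy K n) / \<epsilon>"
    using assms truncated_abundancy_le by (intro card_le_sum_divide) auto
  also have "\<dots> \<le> real N / real K / \<epsilon>" using * assms by (intro divide_right_mono) auto
  finally show ?thesis by simp
qed

section \<open>Rarity of the window below a threshold\<close>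

lemma sum_of_bool_multiples:
  assumes "d dvd M" "0 < d"
  shows "(\<Sum>n = 1..M. of_bool (d dvd n)) = real M / real d"
  unfolding sum_of_bool_card[OF finite_atLeastAtMost]
  using assms card_multiples[of d M] by (simp add: real_of_nat_div)

definition prime_count :: "nat set \<Rightarrow> nat \<Rightarrow> real" where
  "prime_count Q n = (\<Sum>p\<in>Q. of_bool (p dvd n))"

text \<open>Over the full period \<open>M\<close>, divisibilities by distinct primes
  \<open>p\<close> and \<open>q\<close> of \<open>Q\<close> are exactly uncorrelated, because
  \<open>p * q\<close> divides \<open>M\<close> too. The variances therefore add up, and each is
  below \<open>1 / p\<close>.\<close>

lemma prime_count_variance_le:
  assumes "finite Q" "\<And>p. p \<in> Q \<Longrightarrow> prime p" "\<And>p. p \<in> Q \<Longrightarrow> p dvd M"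
  defines "\<mu> \<equiv> \<Sum>p\<in>Q. 1 / real p"
  shows "(\<Sum>n = 1..M. (prime_count Q n - \<mu>)\<^sup>2) \<le> real M * \<mu>"
proof -
  have pos: "0 < p" if "p \<in> Q" for p using assms(2)[OF that] prime_gt_0_nat by blast
  have mean: "(\<Sum>n = 1..M. of_bool (p dvd n)) = real M / real p" if "p \<in> Q" for p
    using sum_of_bool_multiples[OF assms(3)[OF that] pos[OF that]] .
  \<comment> \<open>Keeping the product term on the diagonal, where it only weakens the bound, lets
    the double sum collapse to \<open>\<mu>\<^sup>2\<close> plus the diagonal part.\<close>
  have pair: "(\<Sum>n = 1..M. of_bool (p dvd n) * of_bool (q dvd n)) \<le>
      real M * (1 / real p * (1 / real q)) + (if p = q then real M / real p else 0)"
    if "p \<in> Q" "q \<in> Q" for p q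
  proof (cases "p = q")
    case True
    then have "(\<Sum>n = 1..M. of_bool (p dvd n) * of_bool (q dvd n)) = real M / real p"
      using mean[OF that(1)] by (simp flip: of_bool_conj)
    then show ?thesis using True by simp
  next
    case False
    then have "coprime p q" using that assms(2) primes_coprime by blast
    then have "p * q dvd n \<longleftrightarrow> p dvd n \<and> q dvd n" for n
      using divides_mult by (auto intro: dvd_mult_left dvd_mult_right)
    then have "(\<Sum>n = 1..M. of_bool (p dvd n) * of_bool (q dvd n)) = real M / real (p * q)"
      using sum_of_bool_multiples[of "p * q" M] that assms(3) pos
      by (simp flip: of_bool_conj)
    then show ?thesis using False by simp
  qed
  have "(\<Sum>n = 1..M. prime_count Q n) = (\<Sum>p\<in>Q. \<Sum>n = 1..M. of_bool (p dvd n))"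
    unfolding prime_count_def by (rule sum.swap)
  also have "\<dots> = real M * \<mu>" using mean by (simp add: \<mu>_def sum_distrib_left)
  finally have m1: "(\<Sum>n = 1..M. prime_count Q n) = real M * \<mu>" .
  have "(\<Sum>n = 1..M. (prime_count Q n)\<^sup>2)
      = (\<Sum>n = 1..M. \<Sum>p\<in>Q. \<Sum>q\<in>Q. of_bool (p dvd n) * of_bool (q dvd n))"
    unfolding prime_count_def power2_eq_square by (simp add: sum_product)
  also have "\<dots> = (\<Sum>p\<in>Q. \<Sum>n = 1..M. \<Sum>q\<in>Q. of_bool (p dvd n) * of_bool (q dvd n))"
    by (rule sum.swap)
  also have "\<dots> = (\<Sum>p\<in>Q. \<Sum>q\<in>Q. \<Sum>n = 1..M. of_bool (p dvd n) * of_bool (q dvd n))"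
    by (intro sum.cong refl sum.swap)
  also have "\<dots> \<le> (\<Sum>p\<in>Q. \<Sum>q\<in>Q. real M * (1 / real p * (1 / real q))
      + (if p = q then real M / real p else 0))"
    by (intro sum_mono pair)
  also have "\<dots> = real M * \<mu>\<^sup>2 + real M * \<mu>"
    using \<open>finite Q\<close>
  proof -
    have "\<mu>\<^sup>2 = (\<Sum>p\<in>Q. \<Sum>q\<in>Q. 1 / real p * (1 / real q))"
      unfolding power2_eq_square \<mu>_def sum_product ..
    moreover have "(\<Sum>p\<in>Q. \<Sum>q\<in>Q. if p = q then real M / real p else 0) = real M * \<mu>"
      using \<open>finite Q\<close> by (simp add: \<mu>_def sum_distrib_left)
    ultimately show ?thesis by (simp only: sum.distrib sum_distrib_left)
  qed
  finally have m2: "(\<Sum>n = 1..M. (prime_count Q n)\<^sup>2) \<le> real M * \<mu>\<^sup>2 + real M * \<mu>" .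
  have "(\<Sum>n = 1..M. (prime_count Q n - \<mu>)\<^sup>2)
      = (\<Sum>n = 1..M. (prime_count Q n)\<^sup>2 + \<mu>\<^sup>2 - 2 * \<mu> * prime_count Q n)"
    by (simp add: power2_diff algebra_simps)
  also have "\<dots> = (\<Sum>n = 1..M. (prime_count Q n)\<^sup>2) + real M * \<mu>\<^sup>2 - 2 * \<mu> * (\<Sum>n = 1..M. prime_count Q n)"
    by (simp add: sum.distrib sum_subtractf sum_distrib_left)
  also have "\<dots> \<le> real M * \<mu>"
    using m2 unfolding m1 by (simp add: power2_eq_square algebra_simps)
  finally show ?thesis .
qed

text \<open>Cauchy-Schwarz combined with the variance bound, carried out pointwise as
  \<open>t \<le> t\<^sup>2 / (2 * s) + s / 2\<close>. The value \<open>s = sqrt \<mu>\<close>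
  balances the two terms at \<open>M * s / 2\<close> each.\<close>

lemma sum_prime_count_deviation_le:
  fixes U :: "nat \<Rightarrow> real"
  assumes "finite Q" "\<And>p. p \<in> Q \<Longrightarrow> prime p" "\<And>p. p \<in> Q \<Longrightarrow> p dvd M"
    and U: "\<And>n. U n \<in> {0, 1}"
  defines "\<mu> \<equiv> \<Sum>p\<in>Q. 1 / real p"
  assumes "0 < \<mu>"
  shows "(\<Sum>n = 1..M. U n * (prime_count Q n - \<mu>)) \<le> real M * sqrt \<mu>"
proof -
  define s where "s = sqrt \<mu>"
  have s: "0 < s" "s\<^sup>2 = \<mu>" using \<open>0 < \<mu>\<close> by (auto simp: s_def)
  have "U n * t \<le> t\<^sup>2 / (2 * s) + s / 2" for n t
  proof -
    have "0 \<le> (t - s)\<^sup>2 / (2 * s)" using s by simp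
    also have "\<dots> = t\<^sup>2 / (2 * s) + s / 2 - t"
      using s(1) by (simp add: power2_eq_square field_simps)
    finally have "t \<le> t\<^sup>2 / (2 * s) + s / 2" by simp
    then show ?thesis using U[of n] s by auto
  qed
  then have "(\<Sum>n = 1..M. U n * (prime_count Q n - \<mu>))
      \<le> (\<Sum>n = 1..M. (prime_count Q n - \<mu>)\<^sup>2 / (2 * s) + s / 2)"
    by (intro sum_mono) blast
  also have "\<dots> = (\<Sum>n = 1..M. (prime_count Q n - \<mu>)\<^sup>2) / (2 * s) + real M * s / 2"
    by (simp add: sum.distrib sum_divide_distrib)
  also have "\<dots> \<le> real M * s\<^sup>2 / (2 * s) + real M * s / 2"
    using prime_count_variance_le[OF assms(1-3)] s
    by (intro add_right_mono divide_right_mono) (auto simp: \<mu>_def)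
  also have "\<dots> = real M * s" using s(1) by (simp add: power2_eq_square)
  finally show ?thesis by (simp add: s_def)
qed

text \<open>Over the full period \<open>K!\<close> the covariance is exactly a sum of terms
  \<open>(U (p * m) - U m) / p\<close>. The condition \<open>Q \<subseteq> {..K}\<close> makes each
  \<open>p\<close> divide \<open>K!\<close> and count in the truncated sum. The \<open>+ 1\<close>
  pays for window elements divisible by some \<open>p\<close>, whose share is at most the sum of
  \<open>1 / p\<^sup>2\<close>.\<close>

lemma card_truncated_abundancy_window_le:
  assumes "finite Q" and prime: "\<And>p. p \<in> Q \<Longrightarrow> prime p" and "Q \<subseteq> {..K}"
    and \<epsilon>: "\<And>p. p \<in> Q \<Longrightarrow> \<epsilon> \<le> 1 / real p"
  defines "\<mu> \<equiv> \<Sum>p\<in>Q. 1 / real p"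
  assumes "0 < \<mu>"
  shows "real (card {n \<in> {1..fact K}. c - \<epsilon> \<le> truncated_abundancy K n \<and> truncated_abundancy K n < c}) * \<mu>
    \<le> fact K * (sqrt \<mu> + 1)"
proof -
  define M :: nat where "M = fact K"
  define U :: "nat \<Rightarrow> real" where "U n = of_bool (c \<le> truncated_abundancy K n)" for n
  define W :: "nat \<Rightarrow> real" where
    "W n = of_bool (c - \<epsilon> \<le> truncated_abundancy K n \<and> truncated_abundancy K n < c)" for n
  have pos: "0 < p" if "p \<in> Q" for p using prime[OF that] prime_gt_0_nat by blast
  have pK: "p \<in> {1..K}" if "p \<in> Q" for p using pos[OF that] that \<open>Q \<subseteq> {..K}\<close> by auto
  have dvd: "p dvd M" if "p \<in> Q" for p using pK[OF that] by (simp add: M_def dvd_fact)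
  have Uper: "U (n + M) = U n" for n by (simp add: U_def M_def truncated_abundancy_periodic)
  have mult: "(\<Sum>n = 1..M. of_bool (p dvd n) * U n) = (\<Sum>m = 1..M. U (p * m)) / real p" if "p \<in> Q" for p
  proof -
    have "(\<Sum>n = 1..M. of_bool (p dvd n) * U n) = (\<Sum>n | n \<in> {1..M} \<and> p dvd n. U n)"
      unfolding sum.inter_filter[OF finite_atLeastAtMost] by (intro sum.cong) auto
    then show ?thesis
      using sum_periodic_multiples[of U M p] Uper dvd[OF that] pos[OF that] by (simp add: field_simps)
  qed
  \<comment> \<open>The right-hand side is nonnegative by monotonicity. If \<open>m\<close> lies in
    the window and \<open>p\<close> does not divide it, then \<open>U m = 0\<close>, and the gain of
    at least \<open>1 / p \<ge> \<epsilon>\<close> forces \<open>U (p * m) = 1\<close>.\<close>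
  have pivotal: "W m * (1 - of_bool (p dvd m)) \<le> U (p * m) - U m" if "p \<in> Q" for p m
  proof -
    have "truncated_abundancy K m \<le> truncated_abundancy K (p * m)"
      by (rule truncated_abundancy_mono) simp
    then show ?thesis
      using truncated_abundancy_mult_ge[OF _ pK[OF that], of m] \<epsilon>[OF that]
      by (auto simp: W_def U_def)
  qed
  have "(\<Sum>n = 1..M. U n * (prime_count Q n - \<mu>))
      = (\<Sum>n = 1..M. \<Sum>p\<in>Q. of_bool (p dvd n) * U n - U n / real p)"
    by (simp add: prime_count_def \<mu>_def sum_subtractf sum_distrib_left algebra_simps)
  also have "\<dots> = (\<Sum>p\<in>Q. \<Sum>n = 1..M. of_bool (p dvd n) * U n - U n / real p)"
    by (rule sum.swap)
  also have "\<dots> = (\<Sum>p\<in>Q. \<Sum>m = 1..M. (U (p * m) - U m) / real p)"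
  proof (rule sum.cong[OF refl])
    fix p assume "p \<in> Q"
    show "(\<Sum>n = 1..M. of_bool (p dvd n) * U n - U n / real p) = (\<Sum>m = 1..M. (U (p * m) - U m) / real p)"
      unfolding sum_subtractf mult[OF \<open>p \<in> Q\<close>] diff_divide_distrib sum_divide_distrib ..
  qed
  also have "\<dots> \<ge> (\<Sum>p\<in>Q. \<Sum>m = 1..M. W m * (1 - of_bool (p dvd m)) / real p)"
    by (intro sum_mono divide_right_mono pivotal) auto
  finally have lower: "(\<Sum>p\<in>Q. \<Sum>m = 1..M. W m * (1 - of_bool (p dvd m)) / real p)
      \<le> (\<Sum>n = 1..M. U n * (prime_count Q n - \<mu>))" .
  have "(\<Sum>p\<in>Q. (\<Sum>m = 1..M. W m * of_bool (p dvd m)) / real p) \<le> (\<Sum>p\<in>Q. real M * (1 / real p ^ 2))"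
  proof (intro sum_mono)
    fix p assume "p \<in> Q"
    have "(\<Sum>m = 1..M. W m * of_bool (p dvd m)) \<le> (\<Sum>m = 1..M. of_bool (p dvd m))"
      by (intro sum_mono) (auto simp: W_def)
    also have "\<dots> = real M / real p"
      using sum_of_bool_multiples[OF dvd pos] \<open>p \<in> Q\<close> by blast
    finally show "(\<Sum>m = 1..M. W m * of_bool (p dvd m)) / real p \<le> real M * (1 / real p ^ 2)"
      using pos[OF \<open>p \<in> Q\<close>] by (simp add: power2_eq_square field_simps)
  qed
  also have "\<dots> = real M * (\<Sum>p\<in>Q. 1 / real p ^ 2)" by (simp add: sum_distrib_left)
  also have "\<dots> \<le> real M * (\<Sum>d = Suc 1..K. 1 / real d ^ 2)"
  proof (intro mult_left_mono sum_mono2)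
    show "Q \<subseteq> {Suc 1..K}" using prime_ge_2_nat[OF prime] pK by fastforce
  qed auto
  also have "\<dots> \<le> real M * 1" using sum_inverse_squares_le[of 1 K] by (intro mult_left_mono) auto
  finally have dvd_part: "(\<Sum>p\<in>Q. (\<Sum>m = 1..M. W m * of_bool (p dvd m)) / real p) \<le> real M" by simp
  have "(\<Sum>p\<in>Q. \<Sum>m = 1..M. W m * (1 - of_bool (p dvd m)) / real p)
      = (\<Sum>p\<in>Q. (\<Sum>m = 1..M. W m) * (1 / real p) - (\<Sum>m = 1..M. W m * of_bool (p dvd m)) / real p)"
    by (rule sum.cong[OF refl])
       (simp only: sum_subtractf right_diff_distrib diff_divide_distrib sum_divide_distrib mult_1_right times_divide_eq_right)
  also have "\<dots> = (\<Sum>m = 1..M. W m) * \<mu> - (\<Sum>p\<in>Q. (\<Sum>m = 1..M. W m * of_bool (p dvd m)) / real p)"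
    unfolding sum_subtractf \<mu>_def sum_distrib_left ..
  finally have "(\<Sum>m = 1..M. W m) * \<mu> - real M \<le> (\<Sum>n = 1..M. U n * (prime_count Q n - \<mu>))"
    using lower dvd_part by linarith
  also have "\<dots> \<le> real M * sqrt \<mu>"
    using sum_prime_count_deviation_le[OF \<open>finite Q\<close> prime dvd, of U] \<open>0 < \<mu>\<close>
    by (auto simp: \<mu>_def U_def)
  finally have "(\<Sum>m = 1..M. W m) * \<mu> \<le> real M * (sqrt \<mu> + 1)" by (simp add: algebra_simps)
  then show ?thesis unfolding W_def sum_of_bool_card[OF finite_atLeastAtMost] by (simp add: M_def)
qed

section \<open>Divergence of the sum of the prime reciprocals\<close>

text \<open>A number is determined by its squarefree part, hence by a subset of \<open>Z\<close>,
  and by the root of its square part, which is at most \<open>N\<close>.\<close>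

lemma card_prime_factors_subset_le:
  assumes "finite Z"
  shows "card {n \<in> {1..N ^ 2}. prime_factors n \<subseteq> Z} \<le> 2 ^ card Z * N"
proof -
  let ?A = "{n \<in> {1..N ^ 2}. prime_factors n \<subseteq> Z}"
  let ?f = "\<lambda>n::nat. (prime_factors (squarefree_part n), square_part n)"
  have "inj_on ?f ?A"
  proof (rule inj_onI)
    fix m n assume "m \<in> ?A" "n \<in> ?A" and eq: "?f m = ?f n"
    have "squarefree_part k = \<Prod>(prime_factors (squarefree_part k))" for k :: nat
    proof -
      have "squarefree_part k = (\<Prod>p\<in>prime_factors (squarefree_part k). p ^ multiplicity p (squarefree_part k))"
        by (simp add: prod_prime_factors)
      also have "\<dots> = \<Prod>(prime_factors (squarefree_part k))"
        using squarefree_factorial_semiring'[of "squarefree_part k"] by (intro prod.cong) auto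
      finally show ?thesis .
    qed
    then have "squarefree_part m = squarefree_part n" using eq by (metis prod.inject)
    then show "m = n" using eq squarefree_decompose by (metis prod.inject)
  qed
  moreover have "?f ` ?A \<subseteq> Pow Z \<times> {1..N}"
  proof (rule image_subsetI)
    fix n assume "n \<in> ?A"
    then have n: "0 < n" "n \<le> N ^ 2" "prime_factors n \<subseteq> Z" by auto
    have "prime_factors (squarefree_part n) \<subseteq> prime_factors n"
      using n squarefree_decompose[of n] by (intro dvd_prime_factors) (auto simp: dvd_def)
    moreover have "square_part n ^ 2 \<le> n" "n \<le> N ^ 2"
      using n dvd_imp_le[OF square_part_square_dvd[of n]] by auto
    then have "square_part n \<le> N" by (metis le_trans power2_nat_le_eq_le)
    moreover have "1 \<le> square_part n" using n square_part_0_iff[of n] by linarith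
    ultimately show "?f n \<in> Pow Z \<times> {1..N}" using n(3) by simp
  qed
  moreover have "finite (Pow Z \<times> {1..N})" using assms by simp
  ultimately have "card ?A \<le> card (Pow Z \<times> {1..N})" by (rule card_inj_on_le)
  then show ?thesis using assms by (simp add: card_cartesian_product card_Pow)
qed

text \<open>Erdos's argument: if the sums were bounded, the primes outside some finite
  \<open>Z\<close> would contribute at most \<open>1 / 2\<close>. Then at least half of the numbers
  up to \<open>N\<^sup>2\<close> would have all their prime factors in \<open>Z\<close>, but there
  are at most \<open>2 ^ card Z * N\<close> of those.\<close>

lemma sum_prime_reciprocals_gt:
  "\<exists>Q. finite Q \<and> (\<forall>p\<in>Q. prime (p::nat)) \<and> (C::real) < (\<Sum>p\<in>Q. 1 / real p)"
proof (rule ccontr)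
  assume no_sum: "\<not> ?thesis"
  have bound: "(\<Sum>p\<in>F. 1 / real p) \<le> C" if "finite F" "F \<subseteq> {p. prime p}" for F :: "nat set"
    by (rule ccontr) (use that no_sum in \<open>auto simp: not_le\<close>)
  have "(\<lambda>p. 1 / real p) summable_on {p. prime p}"
    using bound by (intro nonneg_bounded_partial_sums_imp_summable_on[where C = C] eventually_finite_subsets_at_top_weakI) auto
  then obtain Z where Z: "finite Z" "Z \<subseteq> {p. prime p}"
    and tail: "\<And>F. finite F \<Longrightarrow> F \<subseteq> {p. prime p} - Z \<Longrightarrow> (\<Sum>p\<in>F. 1 / real p) \<le> 1 / 2"
  proof -
    assume sm: "(\<lambda>p. 1 / real p) summable_on {p. prime p}"
    let ?S = "infsum (\<lambda>p. 1 / real p) {p::nat. prime p}"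
    have "(sum (\<lambda>p. 1 / real p) \<longlongrightarrow> ?S) (finite_subsets_at_top {p::nat. prime p})"
      using has_sum_infsum[OF sm] by (simp add: has_sum_def)
    then have "eventually (\<lambda>Z. ?S - 1 / 2 < (\<Sum>p\<in>Z. 1 / real p)) (finite_subsets_at_top {p::nat. prime p})"
      by (rule order_tendstoD) simp
    then obtain Z where Z: "finite Z" "Z \<subseteq> {p::nat. prime p}"
      and gt: "?S - 1 / 2 < (\<Sum>p\<in>Z. 1 / real p)"
      unfolding eventually_finite_subsets_at_top by blast
    show ?thesis
    proof (rule that[OF Z])
      fix F assume F: "finite F" "F \<subseteq> {p::nat. prime p} - Z"
      have "(\<Sum>p\<in>Z. 1 / real p) + (\<Sum>p\<in>F. 1 / real p) = (\<Sum>p\<in>Z \<union> F. 1 / real p)"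
        using F Z by (subst sum.union_disjoint) auto
      also have "\<dots> \<le> ?S"
        using F Z by (intro finite_sum_le_infsum sm) auto
      finally show "(\<Sum>p\<in>F. 1 / real p) \<le> 1 / 2" using gt by linarith
    qed
  qed
  \<comment> \<open>Just large enough that \<open>2 * 2 ^ card Z * N < N\<^sup>2\<close>.\<close>
  define N where "N = 2 * 2 ^ card Z + (1::nat)"
  let ?F = "{p \<in> {1..N ^ 2}. prime p \<and> p \<notin> Z}"
  have "{1..N ^ 2} \<subseteq> {n \<in> {1..N ^ 2}. prime_factors n \<subseteq> Z} \<union> (\<Union>p\<in>?F. {n \<in> {1..N ^ 2}. p dvd n})"
  proof
    fix n assume n: "n \<in> {1..N ^ 2}"
    show "n \<in> {n \<in> {1..N ^ 2}. prime_factors n \<subseteq> Z} \<union> (\<Union>p\<in>?F. {n \<in> {1..N ^ 2}. p dvd n})"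
    proof (cases "prime_factors n \<subseteq> Z")
      case False
      then obtain p where p: "prime p" "p dvd n" "p \<notin> Z" by auto
      then have "1 \<le> p" "p \<le> n" using n dvd_imp_le[of p n] prime_ge_1_nat by auto
      then have "p \<in> ?F" using n p by simp
      then show ?thesis using n p by blast
    qed (use n in blast)
  qed
  then have "card {1..N ^ 2} \<le> card ({n \<in> {1..N ^ 2}. prime_factors n \<subseteq> Z} \<union> (\<Union>p\<in>?F. {n \<in> {1..N ^ 2}. p dvd n}))"
    by (intro card_mono) auto
  also have "\<dots> \<le> card {n \<in> {1..N ^ 2}. prime_factors n \<subseteq> Z} + (\<Sum>p\<in>?F. card {n \<in> {1..N ^ 2}. p dvd n})"
    by (intro order.trans[OF card_Un_le] add_left_mono card_UN_le) auto
  finally have "real (N ^ 2) \<le> real (card {n \<in> {1..N ^ 2}. prime_factors n \<subseteq> Z})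
      + (\<Sum>p\<in>?F. real (card {n \<in> {1..N ^ 2}. p dvd n}))"
    by (simp flip: of_nat_sum of_nat_add)
  also have "(\<Sum>p\<in>?F. real (card {n \<in> {1..N ^ 2}. p dvd n})) \<le> (\<Sum>p\<in>?F. real (N ^ 2) * (1 / real p))"
    using card_multiples_le[of "N ^ 2"] by (intro sum_mono) simp
  also have "\<dots> = real (N ^ 2) * (\<Sum>p\<in>?F. 1 / real p)" by (simp add: sum_distrib_left)
  also have "\<dots> \<le> real (N ^ 2) * (1 / 2)" by (intro mult_left_mono tail) auto
  finally have "real (N ^ 2) \<le> 2 * real (card {n \<in> {1..N ^ 2}. prime_factors n \<subseteq> Z})" by simp
  also have "\<dots> \<le> 2 * real (2 ^ card Z * N)"
    by (intro mult_left_mono of_nat_mono card_prime_factors_subset_le Z) simp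
  finally have "real (N ^ 2) \<le> real (2 * 2 ^ card Z * N)" by simp
  then have "N * N \<le> 2 * 2 ^ card Z * N" unfolding of_nat_le_iff by (simp add: power2_eq_square)
  then show False by (simp add: N_def)
qed

section \<open>Existence of the density\<close>

text \<open>With \<open>F\<close> the count in one period and \<open>q = N div M\<close>, both the
  count and \<open>r * N\<close> lie between \<open>q * F\<close> and \<open>(q + 1) * F\<close>,
  and \<open>F \<le> M\<close>.\<close>

lemma card_periodic:
  assumes "0 < M" and per: "\<And>n. P (n + M) \<longleftrightarrow> P n"
  defines "r \<equiv> real (card {n \<in> {1..M}. P n}) / real M"
  shows "\<bar>real (card {n \<in> {1..N}. P n}) - r * real N\<bar> \<le> real M"
proof -
  define f :: "nat \<Rightarrow> real" where "f n = of_bool (P n)" for n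
  define q where "q = N div M"
  have card_eq: "(\<Sum>n = 1..k. f n) = real (card {n \<in> {1..k}. P n})" for k
    unfolding f_def by (rule sum_of_bool_card) simp
  define F where "F = (\<Sum>n = 1..M. f n)"
  have F: "0 \<le> F" "F \<le> real M" "F = r * real M"
  proof -
    show "0 \<le> F" by (simp add: F_def f_def sum_nonneg)
    have "F \<le> (\<Sum>n = 1..M. 1)" unfolding F_def f_def by (intro sum_mono) simp
    then show "F \<le> real M" by simp
    show "F = r * real M" using \<open>0 < M\<close> card_eq[of M] by (simp add: F_def r_def)
  qed
  have qM: "q * M \<le> N" "N \<le> Suc q * M"
    using \<open>0 < M\<close> div_times_less_eq_dividend[of N M] dividend_less_div_times[of M N] by (auto simp: q_def)
  have sum_eq: "(\<Sum>n = 1..k * M. f n) = real k * F" for k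
    unfolding F_def using per by (intro sum_periodic) (simp add: f_def)
  have "(\<Sum>n = 1..q * M. f n) \<le> (\<Sum>n = 1..N. f n)"
    using qM by (intro sum_mono2) (auto simp: f_def)
  moreover have "(\<Sum>n = 1..N. f n) \<le> (\<Sum>n = 1..Suc q * M. f n)"
    using qM by (intro sum_mono2) (auto simp: f_def)
  ultimately have S: "real q * F \<le> (\<Sum>n = 1..N. f n)" "(\<Sum>n = 1..N. f n) \<le> real (Suc q) * F"
    unfolding sum_eq by auto
  have r0: "0 \<le> r" by (simp add: r_def)
  have "r * real (q * M) \<le> r * real N" "r * real N \<le> r * real (Suc q * M)"
    using qM r0 by (intro mult_left_mono of_nat_mono; simp)+
  then have "real q * F \<le> r * real N" "r * real N \<le> real (Suc q) * F"
    by (auto simp: F(3) algebra_simps)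
  then show ?thesis using S F(1,2) unfolding card_eq by (auto simp: algebra_simps abs_le_iff)
qed

text \<open>\<open>D\<close> is the density of the periodic set \<open>B\<close>. The nondeficient
  numbers contain \<open>B\<close> and are covered by \<open>B\<close>, the window \<open>W\<close>
  and the set of large tails; \<open>Q\<close>, \<open>\<epsilon>\<close> and \<open>K\<close> are
  chosen in this order to give each of the latter two a share of at most
  \<open>\<eta> / 2\<close>.\<close>

lemma nondeficient_count_bounds:
  fixes \<eta> :: real
  assumes "0 < \<eta>"
  shows "\<exists>D C. \<forall>N. D * real N - C \<le> real (card {n \<in> {1..N}. n \<in> nondeficient_numbers}) \<and>
    real (card {n \<in> {1..N}. n \<in> nondeficient_numbers}) \<le> (D + \<eta>) * real N + C"
proof -
  \<comment> \<open>With \<open>s = sqrt \<mu>\<close>, the two bounds give \<open>s \<ge> 1\<close>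
    and \<open>s \<ge> 4 / \<eta>\<close>, so the window has density at most
    \<open>(s + 1) / \<mu> \<le> 2 / s \<le> \<eta> / 2\<close>.\<close>
  obtain Q :: "nat set" where Q: "finite Q" "\<And>p. p \<in> Q \<Longrightarrow> prime p"
    and Qsum: "max 1 (16 / \<eta>\<^sup>2) < (\<Sum>p\<in>Q. 1 / real p)"
    using sum_prime_reciprocals_gt by metis
  define \<mu> where "\<mu> = (\<Sum>p\<in>Q. 1 / real p)"
  define s where "s = sqrt \<mu>"
  have mu: "1 < \<mu>" "16 / \<eta>\<^sup>2 < \<mu>" using Qsum by (auto simp: \<mu>_def)
  have s: "1 \<le> s" "s * s = \<mu>" using mu by (auto simp: s_def)
  have "sqrt (16 / \<eta>\<^sup>2) \<le> s" unfolding s_def using mu by (intro real_sqrt_le_mono) auto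
  then have s_eta: "4 \<le> \<eta> * s" using \<open>0 < \<eta>\<close> by (simp add: real_sqrt_divide field_simps)
  define m where "m = \<Sum>Q + 1"
  have m: "0 < m" by (simp add: m_def)
  define \<epsilon> where "\<epsilon> = 1 / real m"
  have p_le: "p \<le> m" if "p \<in> Q" for p unfolding m_def using member_le_sum[of p Q "\<lambda>x. x"] Q(1) that by simp
  have eps: "0 < \<epsilon>" "\<And>p. p \<in> Q \<Longrightarrow> \<epsilon> \<le> 1 / real p"
  proof -
    fix p assume "p \<in> Q"
    then show "\<epsilon> \<le> 1 / real p"
      using p_le[of p] Q(2)[of p] prime_gt_0_nat[of p] m unfolding \<epsilon>_def
      by (intro divide_left_mono) auto
  qed (use m in \<open>simp add: \<epsilon>_def\<close>)
  \<comment> \<open>This makes the tail share \<open>1 / (K * \<epsilon>)\<close> at most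
    \<open>\<eta> / 2\<close>; adding \<open>m\<close>, which bounds every prime in
    \<open>Q\<close>, ensures \<open>Q \<subseteq> {..K}\<close>.\<close>
  obtain K0 where K0: "2 / (\<eta> * \<epsilon>) \<le> real K0" using real_arch_simple by blast
  define K where "K = K0 + m"
  have K: "0 < K" "Q \<subseteq> {..K}" "2 / (\<eta> * \<epsilon>) \<le> real K"
    using K0 p_le m by (auto simp: K_def intro: trans_le_add2)
  define M :: nat where "M = fact K"
  have M: "0 < M" by (simp add: M_def)
  define B where "B n \<longleftrightarrow> 2 \<le> truncated_abundancy K n" for n
  define W where "W n \<longleftrightarrow> 2 - \<epsilon> \<le> truncated_abundancy K n \<and> truncated_abundancy K n < 2" for n
  define b where "b = real (card {n \<in> {1..M}. B n}) / real M"
  define w where "w = real (card {n \<in> {1..M}. W n}) / real M"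
  have cB: "\<bar>real (card {n \<in> {1..N}. B n}) - b * real N\<bar> \<le> real M" for N
    unfolding b_def using M
    by (intro card_periodic) (auto simp: B_def M_def truncated_abundancy_periodic)
  have cW: "\<bar>real (card {n \<in> {1..N}. W n}) - w * real N\<bar> \<le> real M" for N
    unfolding w_def using M
    by (intro card_periodic) (auto simp: W_def M_def truncated_abundancy_periodic)
  have "real (card {n \<in> {1..M}. W n}) * \<mu> \<le> real M * (s + 1)"
    using card_truncated_abundancy_window_le[OF Q K(2) eps(2), of 2] mu by (simp add: W_def M_def \<mu>_def s_def)
  then have "w * \<mu> \<le> s + 1" using M by (simp add: w_def field_simps)
  also have "\<dots> \<le> 2 * s" using s by simp
  also have "\<dots> \<le> \<eta> / 2 * s * s" using s s_eta by (simp add: mult_right_mono)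
  finally have w: "w \<le> \<eta> / 2" using mu s by (simp add: mult.assoc)
  have tail: "real (card {n \<in> {1..N}. \<epsilon> \<le> abundancy n - truncated_abundancy K n}) \<le> \<eta> / 2 * real N" for N
  proof -
    have "1 / (real K * \<epsilon>) \<le> \<eta> / 2" using K eps(1) \<open>0 < \<eta>\<close> by (simp add: field_simps)
    then have "1 / (real K * \<epsilon>) * real N \<le> \<eta> / 2 * real N" by (rule mult_right_mono) simp
    moreover have "real N / (real K * \<epsilon>) = 1 / (real K * \<epsilon>) * real N" by simp
    ultimately show ?thesis using card_tail_ge[OF K(1) eps(1), of N] by linarith
  qed
  have "b * real N - 2 * real M \<le> real (card {n \<in> {1..N}. n \<in> nondeficient_numbers}) \<and>
    real (card {n \<in> {1..N}. n \<in> nondeficient_numbers}) \<le> (b + \<eta>) * real N + 2 * real M" for N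
  proof
    let ?A = "{n \<in> {1..N}. n \<in> nondeficient_numbers}" and ?B = "{n \<in> {1..N}. B n}"
      and ?W = "{n \<in> {1..N}. W n}" and ?T = "{n \<in> {1..N}. \<epsilon> \<le> abundancy n - truncated_abundancy K n}"
    have "?B \<subseteq> ?A"
    proof
      fix n assume "n \<in> ?B"
      then have n: "n \<in> {1..N}" "0 < n" "2 \<le> truncated_abundancy K n" by (auto simp: B_def)
      then have "2 \<le> abundancy n" using truncated_abundancy_le[of n K] by linarith
      then show "n \<in> ?A" using n by (simp add: nondeficient_iff_abundancy)
    qed
    then have "card ?B \<le> card ?A" by (intro card_mono) auto
    then show "b * real N - 2 * real M \<le> real (card ?A)" using cB[of N] M by linarith
    \<comment> \<open>Outside \<open>?B\<close> and \<open>?W\<close> the truncated abundancy is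
      below \<open>2 - \<epsilon>\<close>, so the tail must exceed \<open>\<epsilon>\<close> for the
      abundancy to reach 2.\<close>
    have "?A \<subseteq> ?B \<union> ?W \<union> ?T"
      by (auto simp: nondeficient_iff_abundancy B_def W_def)
    then have "card ?A \<le> card (?B \<union> ?W \<union> ?T)" by (intro card_mono) auto
    also have "\<dots> \<le> card ?B + card ?W + card ?T"
      by (intro order.trans[OF card_Un_le] add_right_mono card_Un_le)
    finally have "real (card ?A) \<le> real (card ?B) + real (card ?W) + real (card ?T)" by linarith
    moreover have "w * real N \<le> \<eta> / 2 * real N" using w by (rule mult_right_mono) simp
    ultimately show "real (card ?A) \<le> (b + \<eta>) * real N + 2 * real M"
      using cB[of N] cW[of N] tail[of N] by (simp add: algebra_simps abs_le_iff)
  qed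
  then show ?thesis by blast
qed

lemma counting_ratio_eq:
  "counting_ratio S x = real (card {n \<in> {1..nat \<lfloor>x\<rfloor>}. n \<in> S}) / x" if "0 \<le> x"
proof -
  have "{n \<in> S. 1 \<le> n \<and> real n \<le> x} = {n \<in> {1..nat \<lfloor>x\<rfloor>}. n \<in> S}"
    using that by (auto simp: le_nat_floor le_floor_iff nat_le_iff le_nat_iff)
  then show ?thesis by (simp add: counting_ratio_def)
qed

text \<open>The error \<open>C\<close> vanishes after division by \<open>x\<close>, so the lower and
  upper densities differ by at most \<open>\<eta>\<close> for every
  \<open>\<eta> > 0\<close>.\<close>

lemma ex_density_of_approximate_density:
  assumes approx: "\<And>\<eta>::real. 0 < \<eta> \<Longrightarrow> \<exists>D C. \<forall>N. D * real N - C \<le> real (card {n \<in> {1..N}. n \<in> S}) \<and>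
    real (card {n \<in> {1..N}. n \<in> S}) \<le> (D + \<eta>) * real N + C"
  shows "\<exists>\<delta>::real. has_natural_density S (ereal \<delta>)"
proof -
  have bounds: "\<exists>D. ereal D \<le> lower_density S \<and> upper_density S \<le> ereal (D + \<eta>)" if eta: "0 < \<eta>" for \<eta> :: real
  proof -
    obtain D C where "\<forall>N. D * real N - C \<le> real (card {n \<in> {1..N}. n \<in> S}) \<and>
      real (card {n \<in> {1..N}. n \<in> S}) \<le> (D + \<eta> / 2) * real N + C"
      using approx[OF half_gt_zero[OF eta]] by (elim exE)
    then have DC: "D * real N - C \<le> real (card {n \<in> {1..N}. n \<in> S})"
      "real (card {n \<in> {1..N}. n \<in> S}) \<le> (D + \<eta> / 2) * real N + C" for N
      by simp_all
    \<comment> \<open>\<open>R\<close> collects \<open>C\<close> and the errors from replacing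
      \<open>x\<close> by its floor. For \<open>x \<ge> 4 * R / \<eta>\<close> these are at most
      \<open>x * \<eta> / 4\<close> on either side, which together with the gap
      \<open>\<eta> / 2\<close> makes \<open>\<eta>\<close>.\<close>
    define R where "R = \<bar>D\<bar> + \<bar>D + \<eta> / 2\<bar> + \<bar>C\<bar>"
    have ev: "eventually (\<lambda>x. D - \<eta> / 4 \<le> counting_ratio S x \<and> counting_ratio S x \<le> D + \<eta> / 2 + \<eta> / 4) at_top"
      using eventually_ge_at_top[of "max 1 (4 * R / \<eta>)"]
    proof eventually_elim
      case (elim x)
      define N where "N = nat \<lfloor>x\<rfloor>"
      have x: "1 \<le> x" "R \<le> x * (\<eta> / 4)" using elim eta by (auto simp: field_simps)
      have N: "\<bar>real N - x\<bar> \<le> 1" using x(1) unfolding N_def by linarith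
      have close: "\<bar>a * real N - a * x\<bar> \<le> \<bar>a\<bar>" for a
        using mult_left_mono[OF N, of "\<bar>a\<bar>"] by (simp add: right_diff_distrib flip: abs_mult)
      have "D * x - x * (\<eta> / 4) \<le> real (card {n \<in> {1..N}. n \<in> S})"
        "real (card {n \<in> {1..N}. n \<in> S}) \<le> (D + \<eta> / 2) * x + x * (\<eta> / 4)"
        using DC[of N] close[of D, unfolded abs_diff_le_iff] close[of "D + \<eta> / 2", unfolded abs_diff_le_iff]
          x(2)[unfolded R_def] abs_ge_self[of C] abs_ge_zero[of D] abs_ge_zero[of "D + \<eta> / 2"]
        by linarith+
      then have "(D - \<eta> / 4) * x \<le> real (card {n \<in> {1..N}. n \<in> S})"
        "real (card {n \<in> {1..N}. n \<in> S}) \<le> (D + \<eta> / 2 + \<eta> / 4) * x"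
        by (simp_all add: algebra_simps)
      then show ?case using x(1) by (simp add: counting_ratio_eq N_def pos_le_divide_eq pos_divide_le_eq)
    qed
    have "ereal (D - \<eta> / 4) \<le> lower_density S" unfolding lower_density_def
      by (rule Liminf_bounded) (use ev in \<open>auto elim: eventually_mono\<close>)
    moreover have "upper_density S \<le> ereal (D + \<eta> / 2 + \<eta> / 4)" unfolding upper_density_def
      by (rule Limsup_bounded) (use ev in \<open>auto elim: eventually_mono\<close>)
    moreover have "D + \<eta> / 2 + \<eta> / 4 = (D - \<eta> / 4) + \<eta>" by simp
    ultimately show ?thesis by metis
  qed
  have le: "lower_density S \<le> upper_density S"
    unfolding lower_density_def upper_density_def by (rule Liminf_le_Limsup) simp
  \<comment> \<open>The case \<open>\<eta> = 1\<close> shows that both densities are finite.\<close>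
  obtain D where D: "ereal D \<le> lower_density S" "upper_density S \<le> ereal (D + 1)"
    using bounds[of 1] by auto
  obtain l where l: "lower_density S = ereal l"
    using D le by (cases "lower_density S") auto
  obtain u where u: "upper_density S = ereal u"
    using D le l by (cases "upper_density S") auto
  have "u \<le> l + \<eta>" if "0 < \<eta>" for \<eta>
    using bounds[OF that] l u by auto
  then have "u \<le> l" by (rule field_le_epsilon)
  then have "lower_density S = ereal u" "upper_density S = ereal u" using le l u by auto
  then show ?thesis unfolding has_natural_density_def by blast
qed

lemma ex_density_nondeficient: "\<exists>\<delta>::real. has_natural_density nondeficient_numbers (ereal \<delta>)"
  by (intro ex_density_of_approximate_density nondeficient_count_bounds)

section \<open>Nondeficient numbers that are not perfect with signs\<close>

lemma sum_divisors_complement: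
  fixes f :: "nat \<Rightarrow> 'a::comm_monoid_add"
  assumes "0 < n"
  shows "(\<Sum>d | d dvd n. f d) = (\<Sum>d | d dvd n. f (n div d))"
  using assms
  by (intro sum.reindex_bij_witness[of _ "\<lambda>d. n div d" "\<lambda>d. n div d"]) auto

text \<open>Giving 1 the sign + and \<open>n\<close> the sign - turns the defining equation into a
  vanishing sum over all divisors. Dividing by \<open>n\<close> and replacing \<open>d\<close> by
  \<open>n div d\<close> yields reciprocals.\<close>

lemma pm_one_perfect_imp_signs:
  assumes "pm_one_perfect n"
  shows "\<exists>s :: nat \<Rightarrow> real. (\<forall>d. d dvd n \<longrightarrow> s d \<in> {-1, 1}) \<and> (\<Sum>d | d dvd n. s d / real d) = 0"
proof -
  obtain l :: "nat \<Rightarrow> int" where n: "1 < n"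
    and l: "\<And>d. d dvd n \<Longrightarrow> 1 < d \<Longrightarrow> d < n \<Longrightarrow> l d \<in> {-1, 1}"
    and sum_l: "1 + (\<Sum>d | d dvd n \<and> 1 < d \<and> d < n. l d * int d) = int n"
    using assms unfolding pm_one_perfect_def by blast
  define l' where "l' d = (if d = 1 then 1 else if d = n then -1 else l d)" for d
  have l': "l' d \<in> {-1, 1}" if "d dvd n" for d
    using l[OF that] dvd_imp_le[OF that] dvd_pos_nat[OF _ that] n by (auto simp: l'_def le_less)
  have "{d. d dvd n} = insert 1 (insert n {d. d dvd n \<and> 1 < d \<and> d < n})"
  proof (intro equalityI subsetI)
    fix d assume "d \<in> {d. d dvd n}"
    then show "d \<in> insert 1 (insert n {d. d dvd n \<and> 1 < d \<and> d < n})"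
      using n dvd_imp_le[of d n] dvd_pos_nat[of n d] by auto
  qed (use n in auto)
  then have "(\<Sum>d | d dvd n. l' d * int d)
      = 1 - int n + (\<Sum>d | d dvd n \<and> 1 < d \<and> d < n. l' d * int d)"
    using n by (simp add: l'_def)
  also have "(\<Sum>d | d dvd n \<and> 1 < d \<and> d < n. l' d * int d) = (\<Sum>d | d dvd n \<and> 1 < d \<and> d < n. l d * int d)"
    by (intro sum.cong) (auto simp: l'_def)
  finally have "(\<Sum>d | d dvd n. l' d * int d) = 0" using sum_l by simp
  then have "(\<Sum>d | d dvd n. l' (n div d) * int (n div d)) = 0"
    using sum_divisors_complement[of n "\<lambda>d. l' d * int d"] n by simp
  then have "0 = real_of_int (\<Sum>d | d dvd n. l' (n div d) * int (n div d))" by simp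
  also have "\<dots> = (\<Sum>d | d dvd n. real n * (real_of_int (l' (n div d)) / real d))"
    unfolding of_int_sum by (intro sum.cong) (auto simp: real_of_nat_div)
  also have "\<dots> = real n * (\<Sum>d | d dvd n. real_of_int (l' (n div d)) / real d)"
    by (simp add: sum_distrib_left)
  finally have "(\<Sum>d | d dvd n. real_of_int (l' (n div d)) / real d) = 0" using n by simp
  moreover have "real_of_int (l' (n div d)) \<in> {-1, 1}" if "d dvd n" for d
  proof -
    have "n div d dvd n" using that by (metis dvd_div_mult_self dvd_triv_left)
    then show ?thesis using l'[of "n div d"] by auto
  qed
  ultimately show ?thesis by (intro exI[of _ "\<lambda>d. real_of_int (l' (n div d))"]) auto
qed

text \<open>Raising every sign to 1 shows that \<open>n\<close> is at most the sum of its proper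
  divisors.\<close>

lemma pm_one_perfect_imp_nondeficient:
  assumes "pm_one_perfect n"
  shows "n \<in> nondeficient_numbers"
proof -
  obtain l :: "nat \<Rightarrow> int" where n: "1 < n"
    and l: "\<And>d. d dvd n \<Longrightarrow> 1 < d \<Longrightarrow> d < n \<Longrightarrow> l d \<in> {-1, 1}"
    and sum_l: "1 + (\<Sum>d | d dvd n \<and> 1 < d \<and> d < n. l d * int d) = int n"
    using assms unfolding pm_one_perfect_def by blast
  have "(\<Sum>d | d dvd n \<and> 1 < d \<and> d < n. l d * int d) \<le> (\<Sum>d | d dvd n \<and> 1 < d \<and> d < n. int d)"
    using l by (intro sum_mono) force
  then have "int n + int n \<le> 1 + int n + (\<Sum>d | d dvd n \<and> 1 < d \<and> d < n. int d)" using sum_l by simp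
  also have "\<dots> = (\<Sum>d\<in>insert 1 (insert n {d. d dvd n \<and> 1 < d \<and> d < n}). int d)" using n by simp
  also have "\<dots> \<le> (\<Sum>d | d dvd n. int d)" using n by (intro sum_mono2) auto
  finally have "int (2 * n) \<le> int (divisor_sum n)" by (simp add: divisor_sum_def)
  then show ?thesis using n unfolding of_nat_le_iff by (simp add: nondeficient_numbers_def)
qed

section \<open>Multiples of 18 with a cofactor of small abundancy\<close>

lemma divisors_18: "{d::nat. d dvd 18} = {1, 2, 3, 6, 9, 18}"
proof -
  have "\<forall>d\<in>set [0..<19]. d dvd (18::nat) \<longleftrightarrow> d \<in> {1, 2, 3, 6, 9, 18}" by code_simp
  moreover have "d \<in> set [0..<19]" if "d dvd 18" for d using dvd_imp_le[OF that] by simp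
  ultimately have "{d::nat. d dvd 18} \<subseteq> {1, 2, 3, 6, 9, 18}" by blast
  then show ?thesis by (rule equalityI) simp
qed

lemma abundancy_18: "abundancy 18 = 39 / 18"
  by (simp add: abundancy_def divisors_18)

text \<open>Such a divisor is a product \<open>d * e\<close> with \<open>d dvd a\<close>,
  \<open>e dvd b\<close> and \<open>e \<noteq> 1\<close>. Several pairs may give the same product
  when \<open>a\<close> and \<open>b\<close> are not coprime, hence an inequality.\<close>

lemma sum_new_divisors_le:
  assumes "0 < a" "0 < b"
  shows "(\<Sum>d | d dvd a * b \<and> \<not> d dvd a. 1 / real d) \<le> abundancy a * (abundancy b - 1)"
proof -
  let ?I = "{d. d dvd a} \<times> ({e. e dvd b} - {1})"
  have fin: "finite ?I" using assms by simp
  have "{d. d dvd a * b \<and> \<not> d dvd a} \<subseteq> (\<lambda>(d, e). d * e) ` ?I"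
  proof
    fix x assume x: "x \<in> {d. d dvd a * b \<and> \<not> d dvd a}"
    then obtain d e where "x = d * e" "d dvd a" "e dvd b" using division_decomp[of x a b] by blast
    then show "x \<in> (\<lambda>(d, e). d * e) ` ?I" using x by (auto intro!: image_eqI[of _ _ "(d, e)"])
  qed
  then have "(\<Sum>d | d dvd a * b \<and> \<not> d dvd a. 1 / real d) \<le> (\<Sum>d\<in>(\<lambda>(d, e). d * e) ` ?I. 1 / real d)"
    using fin by (intro sum_mono2) auto
  also have "\<dots> \<le> (\<Sum>x\<in>?I. 1 / real (case x of (d, e) \<Rightarrow> d * e))"
    using sum_image_le[OF fin, of "\<lambda>d. 1 / real d" "\<lambda>(d, e). d * e"] by (simp add: comp_def)
  also have "\<dots> = (\<Sum>d | d dvd a. 1 / real d) * (\<Sum>e\<in>{e. e dvd b} - {1}. 1 / real e)"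
    by (simp add: sum_product sum.cartesian_product case_prod_unfold)
  also have "(\<Sum>e\<in>{e. e dvd b} - {1}. 1 / real e) = abundancy b - 1"
    using assms by (subst sum_diff1) (auto simp: abundancy_def)
  finally show ?thesis by (simp add: abundancy_def)
qed

text \<open>The threshold is set by \<open>39 / 18 * (1 / 39) = 1 / 18\<close>, the least absolute
  value that the divisors of 18 can contribute.\<close>

lemma not_pm_one_perfect_18_mult:
  assumes "0 < q" "abundancy q < 1 + 1 / 39"
  shows "\<not> pm_one_perfect (18 * q)"
proof
  assume "pm_one_perfect (18 * q)"
  then obtain s :: "nat \<Rightarrow> real" where s: "\<And>d. d dvd 18 * q \<Longrightarrow> s d \<in> {-1, 1}"
    and zero: "(\<Sum>d | d dvd 18 * q. s d / real d) = 0"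
    using pm_one_perfect_imp_signs by blast
  let ?R = "{d. d dvd 18 * q \<and> \<not> d dvd 18}"
  have fin: "finite {d. d dvd 18 * q}" using assms by simp
  have "{d. d dvd 18 * q} = {d. d dvd 18} \<union> ?R" by auto
  then have split: "(\<Sum>d | d dvd 18 * q. s d / real d) = (\<Sum>d | d dvd 18. s d / real d) + (\<Sum>d\<in>?R. s d / real d)"
    using fin by (subst sum.union_disjoint[symmetric]) auto
  have "\<bar>\<Sum>d\<in>?R. s d / real d\<bar> \<le> (\<Sum>d\<in>?R. \<bar>s d / real d\<bar>)" by (rule sum_abs)
  also have "\<dots> \<le> (\<Sum>d\<in>?R. 1 / real d)"
    using s by (intro sum_mono) (force simp: abs_divide)
  also have "\<dots> \<le> 39 / 18 * (abundancy q - 1)"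
    using sum_new_divisors_le[of 18 q] assms by (simp add: abundancy_18)
  finally have small: "\<bar>\<Sum>d\<in>?R. s d / real d\<bar> < 1 / 18" using assms by simp
  have main: "18 * (\<Sum>d | d dvd 18. s d / real d) = 18 * s 1 + 9 * s 2 + 6 * s 3 + 3 * s 6 + 2 * s 9 + s 18"
    by (simp add: divisors_18)
  have mem: "s d \<in> {-1, 1}" if "d dvd 18" for d using s that by simp
  define i where "i d = (if s d = 1 then 1 else -1 :: int)" for d
  have si: "s d = real_of_int (i d)" "odd (i d)" if "d dvd 18" for d
    using mem[OF that] by (auto simp: i_def)
  have "18 * (\<Sum>d | d dvd 18. s d / real d)
      = real_of_int (18 * i 1 + 9 * i 2 + 6 * i 3 + 3 * i 6 + 2 * i 9 + i 18)"
    unfolding main by (simp add: si)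
  \<comment> \<open>Only the coefficients 9, 3 and 1 are odd, so the sum is odd for every choice of
    signs.\<close>
  moreover have "odd (18 * i 1 + 9 * i 2 + 6 * i 3 + 3 * i 6 + 2 * i 9 + i 18)"
    using si(2)[of 2] si(2)[of 6] si(2)[of 18] by simp
  then have "1 \<le> \<bar>18 * i 1 + 9 * i 2 + 6 * i 3 + 3 * i 6 + 2 * i 9 + i 18\<bar>"
    by (metis abs_0_eq dvd_0_right int_one_le_iff_zero_less zero_less_abs_iff)
  ultimately have "1 \<le> \<bar>18 * (\<Sum>d | d dvd 18. s d / real d)\<bar>" by linarith
  then show False using small zero unfolding split by linarith
qed

lemma nondeficient_18_mult:
  assumes "0 < q"
  shows "18 * q \<in> nondeficient_numbers"
  using abundancy_mono[of 18 "18 * q"] assms by (simp add: nondeficient_iff_abundancy abundancy_18)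

section \<open>Average abundancy along a progression\<close>

lemma card_dvd_progression_le:
  fixes d M a T :: nat
  assumes "coprime d M" "0 < d"
  shows "real (card {t \<in> {..<T}. d dvd a + M * t}) \<le> real T / real d + 1"
proof -
  \<comment> \<open>As \<open>M\<close> is invertible modulo \<open>d\<close>, all solutions
    \<open>t\<close> lie in one residue class modulo \<open>d\<close>, so \<open>t div d\<close>
    determines \<open>t\<close>.\<close>
  have "inj_on (\<lambda>t. t div d) {t \<in> {..<T}. d dvd a + M * t}"
  proof (rule inj_onI)
    fix t u assume tu: "t \<in> {t \<in> {..<T}. d dvd a + M * t}" "u \<in> {t \<in> {..<T}. d dvd a + M * t}"
      and eq: "t div d = u div d"
    have "int d dvd (int a + int M * int t) - (int a + int M * int u)"
      using tu by (intro dvd_diff) (simp_all flip: of_nat_mult of_nat_add)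
    then have "int d dvd int M * (int t - int u)" by (simp add: algebra_simps)
    then have "int d dvd int t - int u"
      using \<open>coprime d M\<close> by (simp add: coprime_dvd_mult_right_iff)
    then have "int t mod int d = int u mod int d" by (simp add: mod_eq_dvd_iff)
    then have "t mod d = u mod d" by (simp flip: of_nat_mod)
    then show "t = u" using eq by (metis div_mult_mod_eq)
  qed
  moreover have "(\<lambda>t. t div d) ` {t \<in> {..<T}. d dvd a + M * t} \<subseteq> {..T div d}"
    by (auto intro: div_le_mono)
  ultimately have "card {t \<in> {..<T}. d dvd a + M * t} \<le> card {..T div d}"
    by (intro card_inj_on_le) auto
  then have "real (card {t \<in> {..<T}. d dvd a + M * t}) \<le> real (T div d) + 1" by simp
  also have "real (T div d) \<le> real T / real d" by (rule of_nat_div_le_of_nat)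
  finally show ?thesis by simp
qed

text \<open>A crude stand-in for the logarithm; any sublinear bound serves, since it is compared
  with a multiple of \<open>T\<close>.\<close>

lemma sum_inverse_le_sqrt: "(\<Sum>d = 1..n. 1 / real d) \<le> 2 * sqrt (real n)"
proof (induction n)
  case (Suc n)
  define a b where "a = sqrt (real n)" and "b = sqrt (real (Suc n))"
  have ab: "0 \<le> a" "a \<le> b" "0 < b" "b * b - a * a = 1" "real (Suc n) = b * b" by (auto simp: a_def b_def)
  have "1 = (b - a) * (b + a)" using ab(4) by (simp add: algebra_simps)
  also have "\<dots> \<le> (b - a) * (2 * b)" using ab by (intro mult_left_mono) auto
  finally have "1 \<le> (b - a) * (2 * b)" .
  then have "1 / b \<le> 2 * (b - a)" using ab(3) by (simp add: field_simps)
  moreover have "1 / real (Suc n) \<le> 1 / b"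
  proof -
    have "1 \<le> b" by (simp add: b_def)
    then have "b * 1 \<le> b * b" by (intro mult_left_mono) auto
    then show ?thesis unfolding ab(5) using ab(3) by (intro divide_left_mono) auto
  qed
  ultimately show ?case using Suc by (simp add: a_def b_def)
qed simp

text \<open>No \<open>d\<close> with \<open>1 < d \<le> K\<close> divides \<open>1 + M * t\<close>,
  so only divisors above \<open>K\<close> contribute beyond the divisor 1. Their expected counts
  \<open>T / d\<close> yield \<open>T / K\<close>, and the rounding error 1 in each count yields a
  harmonic sum.\<close>

lemma sum_abundancy_progression_le:
  assumes "0 < K" "0 < T"
  defines "M \<equiv> fact K :: nat"
  shows "(\<Sum>t<T. abundancy (1 + M * t) - 1) \<le> real T / real K + 2 * sqrt (real (M * T))"
proof -
  have M: "0 < M" by (simp add: M_def)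
  have dvd_M: "d dvd M * t" if "d \<in> {1..K}" for d t
    using that by (simp add: M_def dvd_fact dvd_mult2)
  have trunc: "truncated_abundancy K (1 + M * t) = 1" for t
  proof -
    have "{d. d \<in> {1..K} \<and> d dvd 1 + M * t} = {1}"
    proof (intro equalityI subsetI)
      fix d assume "d \<in> {d. d \<in> {1..K} \<and> d dvd 1 + M * t}"
      then have "d dvd 1" using dvd_M[of d t] dvd_add_left_iff by blast
      then show "d \<in> {1}" by simp
    qed (use \<open>0 < K\<close> in auto)
    then show ?thesis by (simp add: truncated_abundancy_def)
  qed
  have eq: "abundancy (1 + M * t) - 1 = (\<Sum>d | d \<in> {Suc K..M * T} \<and> d dvd 1 + M * t. 1 / real d)" if "t < T" for t
  proof -
    have "M * t + M * 1 \<le> M * T" using that unfolding distrib_left[symmetric] by (intro mult_left_mono) auto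
    then have "1 + M * t \<in> {1..M * T}" using M by simp
    then show ?thesis using abundancy_eq_truncated_plus[of "1 + M * t" "M * T" K] trunc by simp
  qed
  have cnt: "real (card {t \<in> {..<T}. d dvd 1 + M * t}) \<le> real T / real d + 1" if "0 < d" for d
  proof (cases "coprime d M")
    case True
    then show ?thesis using that by (rule card_dvd_progression_le)
  next
    case False
    \<comment> \<open>A nontrivial common factor of \<open>d\<close> and \<open>M\<close> cannot
      divide \<open>1 + M * t\<close>, so the count is 0.\<close>
    then obtain c where c: "c dvd d" "c dvd M" "\<not> c dvd 1" using not_coprimeE by blast
    then have "\<not> d dvd 1 + M * t" for t by (meson dvd_add_left_iff dvd_mult2 dvd_trans)
    then show ?thesis by simp
  qed
  have "(\<Sum>t<T. abundancy (1 + M * t) - 1)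
      = (\<Sum>t<T. \<Sum>d | d \<in> {Suc K..M * T} \<and> d dvd 1 + M * t. 1 / real d)"
    using eq by (intro sum.cong) auto
  also have "\<dots> = (\<Sum>d = Suc K..M * T. \<Sum>t | t \<in> {..<T} \<and> d dvd 1 + M * t. 1 / real d)"
    by (rule sum.swap_restrict) auto
  also have "\<dots> = (\<Sum>d = Suc K..M * T. real (card {t \<in> {..<T}. d dvd 1 + M * t}) * (1 / real d))"
    by (intro sum.cong) auto
  also have "\<dots> \<le> (\<Sum>d = Suc K..M * T. (real T / real d + 1) * (1 / real d))"
    by (intro sum_mono mult_right_mono cnt) auto
  also have "\<dots> = real T * (\<Sum>d = Suc K..M * T. 1 / real d ^ 2) + (\<Sum>d = Suc K..M * T. 1 / real d)"
  proof -
    have "(real T / d + 1) * (1 / d) = real T * (1 / d ^ 2) + 1 / d" for d :: real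
      by (simp add: power2_eq_square add_divide_distrib)
    then show ?thesis by (simp only: sum.distrib sum_distrib_left)
  qed
  also have "\<dots> \<le> real T * (1 / real K) + (\<Sum>d = 1..M * T. 1 / real d)"
    using sum_inverse_squares_le[OF \<open>0 < K\<close>] by (intro add_mono mult_left_mono sum_mono2) auto
  also have "\<dots> \<le> real T / real K + 2 * sqrt (real (M * T))"
    using sum_inverse_le_sqrt[of "M * T"] by simp
  finally show ?thesis .
qed

text \<open>
  With \<open>M = 78!\<close>, Markov's inequality bounds the number of exceptions by \<open>39 * (T / 78 + 2 * sqrt (M * T))\<close>,
  and the lower bound on \<open>T\<close> makes the second term at most \<open>T / 4\<close>.
\<close>

lemma card_small_abundancy_progression_ge:
  assumes "0 < T" "312\<^sup>2 * fact 78 \<le> real T"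
  shows "real T / 4 \<le> real (card {t \<in> {..<T}. abundancy (1 + fact 78 * t) < 1 + 1 / 39})"
proof -
  define K :: nat where "K = 78"
  define M :: nat where "M = fact K"
  have T: "312\<^sup>2 * real M \<le> real T" using assms(2) by (simp only: M_def K_def of_nat_fact)
  let ?f = "\<lambda>t. abundancy (1 + M * t) - 1"
  have f0: "0 \<le> ?f t" for t
    using abundancy_mono[of 1 "1 + M * t"] by (simp add: abundancy_def)
  have "(312 * sqrt (real (M * T)))\<^sup>2 = (312\<^sup>2 * real M) * real T" by (simp add: power_mult_distrib)
  also have "\<dots> \<le> (real T)\<^sup>2" using T unfolding power2_eq_square[of "real T"] by (rule mult_right_mono) simp
  finally have "312 * sqrt (real (M * T)) \<le> real T" by (rule power2_le_imp_le) simp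
  moreover have "(\<Sum>t<T. ?f t) \<le> real T / 78 + 2 * sqrt (real (M * T))"
    using sum_abundancy_progression_le[of K T] \<open>0 < T\<close> unfolding M_def[symmetric] by (simp add: K_def)
  moreover have "real (card {t \<in> {..<T}. 1 / 39 \<le> ?f t}) \<le> (\<Sum>t<T. ?f t) / (1 / 39)"
    using f0 by (intro card_le_sum_divide) auto
  ultimately have bad: "real (card {t \<in> {..<T}. 1 / 39 \<le> ?f t}) \<le> 3 / 4 * real T" by simp
  have "T = card ({t \<in> {..<T}. 1 / 39 \<le> ?f t} \<union> {t \<in> {..<T}. ?f t < 1 / 39})"
    by (subst card_lessThan[symmetric], intro arg_cong[where f = card]) auto
  also have "\<dots> \<le> card {t \<in> {..<T}. 1 / 39 \<le> ?f t} + card {t \<in> {..<T}. ?f t < 1 / 39}"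
    by (rule card_Un_le)
  finally have "real T \<le> real (card {t \<in> {..<T}. 1 / 39 \<le> ?f t}) + real (card {t \<in> {..<T}. ?f t < 1 / 39})"
    by linarith
  then have "real T / 4 \<le> real (card {t \<in> {..<T}. ?f t < 1 / 39})" using bad by linarith
  also have "{t \<in> {..<T}. ?f t < 1 / 39} = {t \<in> {..<T}. abundancy (1 + M * t) < 1 + 1 / 39}" by auto
  finally show ?thesis unfolding M_def K_def .
qed

text \<open>An eventual lower bound on the ratio, rather than a lower density, can be subtracted
  pointwise from the ratio of the nondeficient numbers.\<close>

lemma ex_nondeficient_not_pm_one_perfect:
  "\<exists>E c. 0 < c \<and> E \<subseteq> nondeficient_numbers - pm_one_perfect_numbers \<and>
    eventually (\<lambda>x. c \<le> counting_ratio E x) at_top"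
proof -
  obtain M :: nat where M: "0 < M"
    and good: "\<And>T. 0 < T \<Longrightarrow> 312\<^sup>2 * real M \<le> real T \<Longrightarrow>
      real T / 4 \<le> real (card {t \<in> {..<T}. abundancy (1 + M * t) < 1 + 1 / 39})"
  proof (rule that[of "fact 78"])
    show "0 < (fact 78 :: nat)" by (rule fact_gt_zero)
    show "real T / 4 \<le> real (card {t \<in> {..<T}. abundancy (1 + fact 78 * t) < 1 + 1 / 39})"
      if "0 < T" "312\<^sup>2 * real (fact 78) \<le> real T" for T
      using card_small_abundancy_progression_ge[OF that(1)] that(2) by (simp only: of_nat_fact)
  qed
  define g where "g t = 18 * (1 + M * t)" for t
  define E where "E = g ` {t. abundancy (1 + M * t) < 1 + 1 / 39}"
  have "E \<subseteq> nondeficient_numbers - pm_one_perfect_numbers"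
    using nondeficient_18_mult not_pm_one_perfect_18_mult
    by (auto simp: E_def g_def pm_one_perfect_numbers_def simp del: mult_Suc_right)
  \<comment> \<open>With \<open>y = x / (18 * M)\<close>, the lower bound on \<open>x\<close> gives
    \<open>y / 2 \<ge> 312\<^sup>2 * M\<close>, so the floor \<open>T\<close> of \<open>y\<close> is
    at least \<open>y / 2\<close> and large enough for the count. This places at least
    \<open>T / 4 \<ge> y / 8 = x / (144 * M)\<close> elements of \<open>E\<close> below
    \<open>x\<close>.\<close>
  moreover have "eventually (\<lambda>x. 1 / (144 * real M) \<le> counting_ratio E x) at_top"
    using eventually_ge_at_top[of "36 * real M * (312\<^sup>2 * real M)"]
  proof eventually_elim
    case (elim x)
    define T where "T = nat \<lfloor>x / (18 * real M)\<rfloor>"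
    have M1: "1 \<le> real M" using M by simp
    define y where "y = x / (18 * real M)"
    have y: "2 * (312\<^sup>2 * real M) \<le> y" using elim M1 by (simp add: y_def field_simps)
    then have "0 \<le> y" by (rule order_trans[rotated]) simp
    then have T: "real T \<le> y" "y - 1 \<le> real T"
      unfolding T_def y_def[symmetric] by linarith+
    have "1 \<le> 312\<^sup>2 * real M" using M1 by simp
    then have T_ge: "y / 2 \<le> real T" "312\<^sup>2 * real M \<le> real T" "0 < real T"
      using T(2) y by linarith+
    let ?G = "{t \<in> {..<T}. abundancy (1 + M * t) < 1 + 1 / 39}"
    have "g ` ?G \<subseteq> {n \<in> E. 1 \<le> n \<and> real n \<le> x}"
    proof
      fix n assume "n \<in> g ` ?G"
      then obtain t where t: "t < T" "n = g t" "n \<in> E" by (auto simp: E_def)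
      have "g t \<le> 18 * (M * Suc t)" using M by (simp add: g_def)
      also have "\<dots> \<le> 18 * (M * T)" using t by (intro mult_left_mono) auto
      finally have "real (g t) \<le> real (18 * (M * T))" by (rule of_nat_mono)
      also have "\<dots> = 18 * real M * real T" by simp
      also have "\<dots> \<le> x" using T(1) M1 by (simp add: y_def field_simps)
      finally show "n \<in> {n \<in> E. 1 \<le> n \<and> real n \<le> x}" using t by (simp add: g_def)
    qed
    moreover have "finite {n \<in> E. 1 \<le> n \<and> real n \<le> x}"
      by (rule finite_subset[of _ "{..nat \<lfloor>x\<rfloor>}"]) (auto simp: le_nat_floor)
    ultimately have "card (g ` ?G) \<le> card {n \<in> E. 1 \<le> n \<and> real n \<le> x}" by (intro card_mono)
    moreover have "card (g ` ?G) = card ?G"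
      using M by (intro card_image) (auto simp: g_def inj_on_def)
    ultimately have "real T / 4 \<le> real (card {n \<in> E. 1 \<le> n \<and> real n \<le> x})"
      using good[OF _ T_ge(2)] T_ge(3) by linarith
    then have "x / (144 * real M) \<le> real (card {n \<in> E. 1 \<le> n \<and> real n \<le> x})" using T_ge(1) by (simp add: y_def)
    moreover have "0 < x" using elim M1 by (smt (verit) mult_pos_pos zero_less_power)
    ultimately show ?case by (simp add: counting_ratio_def field_simps)
  qed
  ultimately show ?thesis using M by (intro exI[of _ E] exI[of _ "1 / (144 * real M)"]) simp
qed

section \<open>Comparison of the densities\<close>

lemma counting_ratio_diff_le:
  assumes "E \<subseteq> A" "P \<subseteq> A - E" "0 \<le> x"
  shows "counting_ratio P x \<le> counting_ratio A x - counting_ratio E x"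
proof -
  let ?C = "\<lambda>S. {n \<in> S. 1 \<le> n \<and> real n \<le> x}"
  have fin: "finite (?C S)" for S
    by (rule finite_subset[of _ "{..nat \<lfloor>x\<rfloor>}"]) (auto simp: le_nat_floor)
  have "card (?C P) + card (?C E) = card (?C P \<union> ?C E)"
    using assms fin by (intro card_Un_disjoint[symmetric]) auto
  also have "\<dots> \<le> card (?C A)" using assms fin by (intro card_mono) auto
  finally have "real (card (?C P)) \<le> real (card (?C A)) - real (card (?C E))" by linarith
  then show ?thesis using \<open>0 \<le> x\<close>
    by (simp add: counting_ratio_def divide_right_mono flip: diff_divide_distrib)
qed

theorem theorem2p4:
  shows "(\<exists>E. E \<subseteq> nondeficient_numbers - pm_one_perfect_numbers \<and> lower_density E > 0) \<and>
         (\<exists>\<delta>. has_natural_density nondeficient_numbers \<delta> \<and>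
              upper_density pm_one_perfect_numbers < \<delta>)"
proof -
  obtain E c where c: "0 < c" and E: "E \<subseteq> nondeficient_numbers - pm_one_perfect_numbers"
    and ev: "eventually (\<lambda>x. c \<le> counting_ratio E x) at_top"
    using ex_nondeficient_not_pm_one_perfect by blast
  obtain \<delta> :: real where \<delta>: "has_natural_density nondeficient_numbers (ereal \<delta>)"
    using ex_density_nondeficient by blast
  have "ereal c \<le> lower_density E"
    unfolding lower_density_def by (rule Liminf_bounded) (use ev in simp)
  then have "0 < lower_density E" using c by (auto intro: less_le_trans[of _ "ereal c"])
  moreover have "upper_density pm_one_perfect_numbers < ereal \<delta>"
  proof -
    \<comment> \<open>Half of \<open>c\<close> absorbs the fluctuation of the nondeficient ratio
      above \<open>\<delta>\<close>; subtracting the full \<open>c\<close> for \<open>E\<close>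
      leaves a gap of \<open>c / 2\<close>.\<close>
    have "Limsup at_top (\<lambda>x. ereal (counting_ratio nondeficient_numbers x)) < ereal (\<delta> + c / 2)"
      using \<delta> c by (simp add: has_natural_density_def upper_density_def)
    then have "eventually (\<lambda>x. ereal (counting_ratio nondeficient_numbers x) < ereal (\<delta> + c / 2)) at_top"
      by (rule Limsup_lessD)
    then have "eventually (\<lambda>x. ereal (counting_ratio pm_one_perfect_numbers x) \<le> ereal (\<delta> - c / 2)) at_top"
      using ev eventually_ge_at_top[of 0]
    proof eventually_elim
      case (elim x)
      have "pm_one_perfect_numbers \<subseteq> nondeficient_numbers - E"
        using E pm_one_perfect_imp_nondeficient by (auto simp: pm_one_perfect_numbers_def)
      then have "counting_ratio pm_one_perfect_numbers x
          \<le> counting_ratio nondeficient_numbers x - counting_ratio E x"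
        using E \<open>0 \<le> x\<close> by (intro counting_ratio_diff_le) auto
      moreover have "counting_ratio nondeficient_numbers x < \<delta> + c / 2" using elim by simp
      ultimately show ?case using \<open>c \<le> counting_ratio E x\<close> by simp
    qed
    then have "upper_density pm_one_perfect_numbers \<le> ereal (\<delta> - c / 2)"
      unfolding upper_density_def by (rule Limsup_bounded)
    also have "\<dots> < ereal \<delta>" using c by simp
    finally show ?thesis .
  qed
  ultimately show ?thesis using E \<delta> by blast
qed

end
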